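(* There exist universal constants $c\ge 1$ and $c'>0$ (independent of $n,f,L,p,N,\hat\varepsilon,x^0$) such that the following holds. Let $f:\mathbb{R}^n\to\mathbb{R}$ be convex and $L$-smooth ($L>0$) with a minimizer $x^*$, let $\hat\varepsilon\in[0,1]$, and let $\widetilde\nabla f$ be a gradient oracle for $f$ with relative noise $\hat\varepsilon$. Let $p\in[1,2]$, $N\ge 1$, and $$a = c\,\max\left\{1,\; N^{p/4}\sqrt{\hat\varepsilon},\; N^{p/2}\hat\varepsilon,\; N^{p}\hat\varepsilon^2\right\}.$$ Then for every initial point $x^0\in\mathbb{R}^n$ the point $y^N$ produced by $N$ iterations of ISTM with parameters $L$, $a$, $p$ satisfies $$f(y^N)-f(x^* )\le \frac{8aLC_1^2R_0^2}{(N+1)^p},\qquad R_0=\|x^0-x^*\|_2,\quad C_1=\sqrt2,$$ and consequently $$f(y^N)-f(x^* )\le c'\max\left\{\frac{LR_0^2}{N^p},\;\frac{\sqrt{\hat\varepsilon}\,LR_0^2}{N^{3p/4}},\;\frac{\hat\varepsilon LR_0^2}{N^{p/2}},\;\hat\varepsilon^2LR_0^2\right\}.$$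
   Context: $\|\cdot\|_2$ is the Euclidean norm and $\langle\cdot,\cdot\rangle$ the standard inner product on $\mathbb{R}^n$. A differentiable $f:\mathbb{R}^n\to\mathbb{R}$ is convex if $f(y)\ge f(x)+\langle\nabla f(x),y-x\rangle$ for all $x,y$, and $L$-smooth if $\|\nabla f(y)-\nabla f(x)\|_2\le L\|y-x\|_2$ for all $x,y$. A gradient oracle with relative noise $\hat\varepsilon\in[0,1]$ is a map $\widetilde\nabla f:\mathbb{R}^n\to\mathbb{R}^n$ with $\|\widetilde\nabla f(x)-\nabla f(x)\|_2\le\hat\varepsilon\|\nabla f(x)\|_2$ for all $x\in\mathbb{R}^n$. Intermediate Similar Triangle Method (ISTM) with initial point $x^0$, number of iterations $N$, smoothness constant $L>0$, step size parameter $a\ge1$, intermediate parameter $p\in[1,2]$: set $A_0=\alpha_0=0$, $y^0=z^0=x^0$; for $k=0,1,\dots,N-1$ set $$\alpha_{k+1}=\frac{(k+2)^{p-1}}{2aL},\qquad A_{k+1}=A_k+\alpha_{k+1},\qquad x^{k+1}=\frac{A_ky^k+\alpha_{k+1}z^k}{A_{k+1}},$$ $$z^{k+1}=z^k-\alpha_{k+1}\widetilde\nabla f(x^{k+1}),\qquad y^{k+1}=\frac{A_ky^k+\alpha_{k+1}z^{k+1}}{A_{k+1}}.$$ The output is $y^N$. *)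

theory Defs
  imports Complex_Main "Jordan_Normal_Form.Matrix"
begin

text \<open>
  The constants of the theorem are chosen before the dimension \<open>n\<close>, so \<open>n\<close> has to be a term
  variable and cannot be the index type of \<open>real ^ 'n\<close>: Euclidean \<open>n\<close>-space is the set
  \<open>carrier_vec n\<close> of real vectors. As the type \<open>real vec\<close> is not a normed space, norm and gradient
  are introduced here. A function on \<open>n\<close>-space is a total function on \<open>real vec\<close> of which only the
  values on \<open>carrier_vec n\<close> are used.
\<close>

definition vnorm :: "real vec \<Rightarrow> real" where
  "vnorm v = sqrt (v \<bullet> v)"

text \<open>Frechet differentiability at \<open>x\<close>, with the derivative represented by the vector \<open>g\<close>.\<close>

definition has_gradient :: "nat \<Rightarrow> (real vec \<Rightarrow> real) \<Rightarrow> real vec \<Rightarrow> real vec \<Rightarrow> bool" where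
  "has_gradient n f x g \<longleftrightarrow> g \<in> carrier_vec n \<and>
     (\<forall>e>0. \<exists>d>0. \<forall>y\<in>carrier_vec n. vnorm (y - x) < d \<longrightarrow>
        \<bar>f y - f x - g \<bullet> (y - x)\<bar> \<le> e * vnorm (y - x))"

definition differentiable_fun :: "nat \<Rightarrow> (real vec \<Rightarrow> real) \<Rightarrow> bool" where
  "differentiable_fun n f \<longleftrightarrow> (\<forall>x\<in>carrier_vec n. \<exists>g. has_gradient n f x g)"

definition gradient :: "nat \<Rightarrow> (real vec \<Rightarrow> real) \<Rightarrow> real vec \<Rightarrow> real vec" where
  "gradient n f x = (THE g. has_gradient n f x g)"

definition convex_fun :: "nat \<Rightarrow> (real vec \<Rightarrow> real) \<Rightarrow> bool" where
  "convex_fun n f \<longleftrightarrow> differentiable_fun n f \<and>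
     (\<forall>x\<in>carrier_vec n. \<forall>y\<in>carrier_vec n. f y \<ge> f x + gradient n f x \<bullet> (y - x))"

definition smooth_fun :: "nat \<Rightarrow> real \<Rightarrow> (real vec \<Rightarrow> real) \<Rightarrow> bool" where
  "smooth_fun n L f \<longleftrightarrow> differentiable_fun n f \<and>
     (\<forall>x\<in>carrier_vec n. \<forall>y\<in>carrier_vec n.
        vnorm (gradient n f y - gradient n f x) \<le> L * vnorm (y - x))"

definition minimizer :: "nat \<Rightarrow> (real vec \<Rightarrow> real) \<Rightarrow> real vec \<Rightarrow> bool" where
  "minimizer n f xs \<longleftrightarrow> xs \<in> carrier_vec n \<and> (\<forall>x\<in>carrier_vec n. f xs \<le> f x)"

definition gradient_oracle ::
  "nat \<Rightarrow> (real vec \<Rightarrow> real) \<Rightarrow> real \<Rightarrow> (real vec \<Rightarrow> real vec) \<Rightarrow> bool" where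
  "gradient_oracle n f eps G \<longleftrightarrow> (\<forall>x\<in>carrier_vec n. G x \<in> carrier_vec n \<and>
     vnorm (G x - gradient n f x) \<le> eps * vnorm (gradient n f x))"

primrec istm_alpha :: "real \<Rightarrow> real \<Rightarrow> real \<Rightarrow> nat \<Rightarrow> real" where
  "istm_alpha L a p 0 = 0"
| "istm_alpha L a p (Suc k) = (real k + 2) powr (p - 1) / (2 * a * L)"

primrec istm_A :: "real \<Rightarrow> real \<Rightarrow> real \<Rightarrow> nat \<Rightarrow> real" where
  "istm_A L a p 0 = 0"
| "istm_A L a p (Suc k) = istm_A L a p k + istm_alpha L a p (Suc k)"

text \<open>The state after \<open>k\<close> iterations is the triple of the \<open>k\<close>-th points \<open>(x, y, z)\<close>;
  \<open>G\<close> is the gradient oracle.\<close>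

primrec istm :: "(real vec \<Rightarrow> real vec) \<Rightarrow> real \<Rightarrow> real \<Rightarrow> real \<Rightarrow> real vec \<Rightarrow> nat
    \<Rightarrow> real vec \<times> real vec \<times> real vec" where
  "istm G L a p x0 0 = (x0, x0, x0)"
| "istm G L a p x0 (Suc k) =
     (let (x, y, z) = istm G L a p x0 k;
          A = istm_A L a p k;
          A' = istm_A L a p (Suc k);
          \<alpha>' = istm_alpha L a p (Suc k);
          x' = (1 / A') \<cdot>\<^sub>v (A \<cdot>\<^sub>v y + \<alpha>' \<cdot>\<^sub>v z);
          z' = z - \<alpha>' \<cdot>\<^sub>v G x';
          y' = (1 / A') \<cdot>\<^sub>v (A \<cdot>\<^sub>v y + \<alpha>' \<cdot>\<^sub>v z')
      in (x', y', z'))"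

definition istm_output ::
  "(real vec \<Rightarrow> real vec) \<Rightarrow> real \<Rightarrow> real \<Rightarrow> real \<Rightarrow> real vec \<Rightarrow> nat \<Rightarrow> real vec" where
  "istm_output G L a p x0 N = (case istm G L a p x0 N of (x, y, z) \<Rightarrow> y)"

end

theory Submission
  imports Defs "HOL-Analysis.Convex"
begin

text \<open>
  The method is a coupling of gradient and mirror descent, and it is analysed by the potential
  \<open>A\<^sub>k (f y\<^sub>k - f x\<^sub>*) + \<parallel>z\<^sub>k - x\<^sub>*\<parallel>\<^sup>2 / 2\<close>. With an exact gradient and short steps it never increases. Relative
  noise adds to the bound for one step the terms \<open>- \<alpha> \<langle>e, z\<^sub>k - x\<^sub>*\<rangle>\<close> and \<open>\<alpha>\<^sup>2 \<parallel>e\<parallel>\<^sup>2\<close>, where the error \<open>e\<close> has norm at most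
  \<open>\<epsilon> \<parallel>\<nabla>f x\<parallel>\<close> and \<open>x\<close> is the new query point. The point of the proof is that these terms can be
  paid for. The gradient of \<open>f\<close> vanishes at the minimizer, so smoothness strengthens the convexity
  inequality between \<open>x\<close> and \<open>x\<^sub>*\<close> by \<open>\<parallel>\<nabla>f x\<parallel>\<^sup>2 / (4 L)\<close> (lemma \<open>minimum_value_lower_bound\<close>). This
  gives a budget of \<open>\<alpha> \<parallel>\<nabla>f x\<parallel>\<^sup>2 / (4 L)\<close> per step. One half of it absorbs \<open>\<alpha>\<^sup>2 \<parallel>e\<parallel>\<^sup>2\<close>; the other
  half, after a weighted arithmetic-geometric mean inequality, absorbs the inner product up to a
  multiple of the squared distance, \<open>2 \<alpha> L \<epsilon>\<^sup>2 \<parallel>z\<^sub>k - x\<^sub>*\<parallel>\<^sup>2\<close> (lemma \<open>similar_triangles_step\<close>).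

  These multiples add up to \<open>2 L \<epsilon>\<^sup>2 A\<^sub>N\<close>. As \<open>A\<^sub>N\<close> has order \<open>N\<^sup>p / (a L)\<close> (lemmas
  \<open>istm_A_lower\<close> and \<open>istm_A_le\<close>), the choice \<open>a \<ge> 8 N\<^sup>p \<epsilon>\<^sup>2\<close> makes this at most \<open>1/4\<close>, and
  induction on \<open>k\<close> keeps every \<open>z\<^sub>k\<close> within \<open>\<surd>2 R\<^sub>0\<close> of \<open>x\<^sub>*\<close> and the potential below \<open>R\<^sub>0\<^sup>2\<close>
  (lemma \<open>istm_potential\<close>). Dividing by \<open>A\<^sub>N\<close> gives the first bound with \<open>c = 8\<close>. The second
  bound follows because division by \<open>N\<^sup>p\<close> turns the four candidates for \<open>a / 8\<close> into the four
  candidates on the right-hand side.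
\<close>

section \<open>Euclidean geometry of carrier vectors\<close>

lemma vnorm_square: "(vnorm v)\<^sup>2 = v \<bullet> v"
  unfolding vnorm_def by (simp add: scalar_prod_def sum_nonneg)

lemma vnorm_nonneg: "0 \<le> vnorm v"
  unfolding vnorm_def by (simp add: scalar_prod_def sum_nonneg)

lemma vnorm_smult: "vnorm (t \<cdot>\<^sub>v v) = \<bar>t\<bar> * vnorm v"
  unfolding vnorm_def by (simp add: real_sqrt_mult mult.assoc[symmetric])

lemma abs_scalar_prod_le_vnorm:
  assumes "v \<in> carrier_vec n" "w \<in> carrier_vec n"
  shows "\<bar>v \<bullet> w\<bar> \<le> vnorm v * vnorm w"
proof -
  have "(v \<bullet> w)\<^sup>2 \<le> (v \<bullet> v) * (w \<bullet> w)"
    using Cauchy_Schwarz_ineq_sum[of "\<lambda>i. v $ i" "\<lambda>i. w $ i" "{0..<n}"] assms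
    by (simp add: scalar_prod_def power2_eq_square)
  also have "\<dots> = (vnorm v * vnorm w)\<^sup>2"
    by (simp add: power_mult_distrib vnorm_square)
  finally show ?thesis
    by (simp add: abs_le_square_iff[symmetric] vnorm_nonneg)
qed

lemma scalar_prod_add_self:
  fixes v w :: "real vec"
  assumes "v \<in> carrier_vec n" "w \<in> carrier_vec n"
  shows "(v + w) \<bullet> (v + w) = v \<bullet> v + 2 * (v \<bullet> w) + w \<bullet> w"
  using assms
  by (simp add: add_scalar_prod_distrib[where n = n] scalar_prod_add_distrib[where n = n]
      comm_scalar_prod[of w n v])

section \<open>Gradients\<close>

text \<open>
  Along a fixed ray the error of the linear approximation is \<open>o(t)\<close>. Uniqueness of the gradient
  and stationarity of minimizers only look at such rays.
\<close>

lemma has_gradient_along_line: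
  assumes "has_gradient n f x g" "x \<in> carrier_vec n" "u \<in> carrier_vec n" "e > 0"
  shows "\<exists>d>0. \<forall>t. 0 < t \<longrightarrow> t < d \<longrightarrow>
    \<bar>f (x + t \<cdot>\<^sub>v u) - f x - t * (g \<bullet> u)\<bar> \<le> e * t"
proof -
  have g: "g \<in> carrier_vec n"
    using assms(1) by (simp add: has_gradient_def)
  \<comment> \<open>The summand 1 keeps \<open>c\<close> positive when \<open>u = 0\<close>.\<close>
  define c where "c = vnorm u + 1"
  have c: "c > 0" "vnorm u < c"
    using vnorm_nonneg[of u] by (auto simp: c_def)
  obtain d where d: "d > 0" and near: "\<And>y. y \<in> carrier_vec n \<Longrightarrow> vnorm (y - x) < d \<Longrightarrow>
      \<bar>f y - f x - g \<bullet> (y - x)\<bar> \<le> e / c * vnorm (y - x)"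
    using assms(1,4) c(1) unfolding has_gradient_def by (meson divide_pos_pos)
  show ?thesis
  proof (intro exI[of _ "d / c"] conjI allI impI)
    show "d / c > 0" using d c by simp
    fix t :: real assume t: "0 < t" "t < d / c"
    have diff: "(x + t \<cdot>\<^sub>v u) - x = t \<cdot>\<^sub>v u"
      using assms by (intro eq_vecI) auto
    have nrm: "vnorm (t \<cdot>\<^sub>v u) = t * vnorm u"
      using t by (simp add: vnorm_smult)
    have le: "t * vnorm u \<le> t * c"
      using t c by simp
    have "t * c < d"
      using t c by (simp add: field_simps)
    then have "\<bar>f (x + t \<cdot>\<^sub>v u) - f x - g \<bullet> (t \<cdot>\<^sub>v u)\<bar> \<le> e / c * (t * vnorm u)"
      using near[of "x + t \<cdot>\<^sub>v u"] assms diff nrm le by simp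
    also have "\<dots> \<le> e / c * (t * c)"
      using le c t assms(4) by (intro mult_left_mono) simp_all
    finally show "\<bar>f (x + t \<cdot>\<^sub>v u) - f x - t * (g \<bullet> u)\<bar> \<le> e * t"
      using c g assms by simp
  qed
qed

text \<open>
  Comparing both linear approximations in the direction \<open>g - h\<close> makes \<open>\<parallel>g - h\<parallel>\<^sup>2\<close> smaller than any
  positive number. Uniqueness is what gives \<^const>\<open>gradient\<close>, a definite description, its meaning.
\<close>

lemma has_gradient_unique:
  assumes "has_gradient n f x g" "has_gradient n f x h" "x \<in> carrier_vec n"
  shows "g = h"
proof -
  have gh: "g \<in> carrier_vec n" "h \<in> carrier_vec n"
    using assms by (auto simp: has_gradient_def)
  define u where "u = g - h"
  have u: "u \<in> carrier_vec n" using gh by (simp add: u_def)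
  have "u \<bullet> u \<le> 0 + e" if e: "e > 0" for e
  proof -
    obtain d1 where d1: "d1 > 0" "\<And>t. 0 < t \<Longrightarrow> t < d1 \<Longrightarrow>
        \<bar>f (x + t \<cdot>\<^sub>v u) - f x - t * (g \<bullet> u)\<bar> \<le> e / 2 * t"
      using has_gradient_along_line[OF assms(1,3) u, of "e / 2"] e by auto
    obtain d2 where d2: "d2 > 0" "\<And>t. 0 < t \<Longrightarrow> t < d2 \<Longrightarrow>
        \<bar>f (x + t \<cdot>\<^sub>v u) - f x - t * (h \<bullet> u)\<bar> \<le> e / 2 * t"
      using has_gradient_along_line[OF assms(2,3) u, of "e / 2"] e by auto
    define t where "t = min d1 d2 / 2"
    have t: "0 < t" "t < d1" "t < d2" using d1(1) d2(1) by (auto simp: t_def)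
    have "t * (g \<bullet> u) - t * (h \<bullet> u) \<le> e * t"
      using abs_le_D2[OF d1(2)[OF t(1,2)]] abs_le_D1[OF d2(2)[OF t(1,3)]] by linarith
    moreover have "u \<bullet> u = g \<bullet> u - h \<bullet> u"
      using gh u minus_scalar_prod_distrib[OF gh u] by (simp add: u_def[symmetric])
    ultimately have "t * (u \<bullet> u) \<le> t * e" by (simp add: right_diff_distrib mult.commute[of e])
    then show ?thesis using t by simp
  qed
  then have "u \<bullet> u \<le> 0" by (rule field_le_epsilon)
  moreover have "(u $ i)\<^sup>2 \<le> u \<bullet> u" if "i < n" for i
    using u that member_le_sum[of i "{0..<n}" "\<lambda>i. u $ i * u $ i"]
    by (simp add: scalar_prod_def power2_eq_square)
  ultimately have "u $ i = 0" if "i < n" for i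
    using that by (metis order_trans power2_less_eq_zero_iff)
  then show ?thesis using gh by (intro eq_vecI) (auto simp: u_def)
qed

lemma has_gradient_gradient:
  assumes "differentiable_fun n f" "x \<in> carrier_vec n"
  shows "has_gradient n f x (gradient n f x)"
proof -
  obtain g where "has_gradient n f x g"
    using assms by (auto simp: differentiable_fun_def)
  then show ?thesis
    unfolding gradient_def using has_gradient_unique assms(2) by (metis (full_types) theI)
qed

lemma gradient_carrier:
  assumes "differentiable_fun n f" "x \<in> carrier_vec n"
  shows "gradient n f x \<in> carrier_vec n"
  using has_gradient_gradient[OF assms] by (simp add: has_gradient_def)

lemma gradient_minimizer:
  assumes "differentiable_fun n f" "minimizer n f xs" "v \<in> carrier_vec n"
  shows "gradient n f xs \<bullet> v = 0"
proof -
  have xs: "xs \<in> carrier_vec n" and min: "\<And>x. x \<in> carrier_vec n \<Longrightarrow> f xs \<le> f x"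
    using assms(2) by (auto simp: minimizer_def)
  note grad = has_gradient_gradient[OF assms(1) xs]
  have descent: "0 \<le> gradient n f xs \<bullet> u + e" if u: "u \<in> carrier_vec n" and e: "e > 0" for u e
  proof -
    obtain d where d: "d > 0" "\<And>t. 0 < t \<Longrightarrow> t < d \<Longrightarrow>
        \<bar>f (xs + t \<cdot>\<^sub>v u) - f xs - t * (gradient n f xs \<bullet> u)\<bar> \<le> e * t"
      using has_gradient_along_line[OF grad xs u e] by auto
    have "0 \<le> (d / 2) * (gradient n f xs \<bullet> u + e)"
      using abs_le_D1[OF d(2)[of "d / 2"]] d(1) min[of "xs + (d / 2) \<cdot>\<^sub>v u"] xs u
      by (simp add: algebra_simps)
    then show ?thesis using d(1) by (simp add: zero_le_mult_iff)
  qed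
  have "0 \<le> gradient n f xs \<bullet> v"
    by (rule field_le_epsilon) (use descent[OF assms(3)] in simp)
  moreover have "0 \<le> gradient n f xs \<bullet> (- v)"
    by (rule field_le_epsilon) (use descent[of "- v"] assms(3) in simp)
  ultimately show ?thesis
    using assms(3) gradient_carrier[OF assms(1) xs] by simp
qed

section \<open>Smooth convex functions\<close>

text \<open>
  Convexity at \<open>y\<close> bounds \<open>f y - f x\<close> by \<open>\<langle>\<nabla>f y, y - x\<rangle>\<close>, and the Lipschitz condition replaces
  \<open>\<nabla>f y\<close> by \<open>\<nabla>f x\<close>. The usual constant \<open>L / 2\<close> would need integration along the segment; the
  factor 2 lost here only affects \<open>c\<close>.
\<close>

lemma smooth_convex_upper_bound:
  assumes cvx: "convex_fun n f" and smooth: "smooth_fun n L f"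
    and x: "x \<in> carrier_vec n" and y: "y \<in> carrier_vec n"
  shows "f y \<le> f x + gradient n f x \<bullet> (y - x) + L * ((y - x) \<bullet> (y - x))"
proof -
  have D: "differentiable_fun n f" using cvx by (simp add: convex_fun_def)
  note gx = gradient_carrier[OF D x] and gy = gradient_carrier[OF D y]
  have "f x \<ge> f y + gradient n f y \<bullet> (x - y)"
    using cvx x y by (simp add: convex_fun_def)
  moreover have "gradient n f y \<bullet> (x - y) = - (gradient n f y \<bullet> (y - x))"
    using x y gy by (simp add: scalar_prod_minus_distrib[where n = n])
  moreover have "gradient n f y \<bullet> (y - x) - gradient n f x \<bullet> (y - x)
      = (gradient n f y - gradient n f x) \<bullet> (y - x)"
    using x y gx gy by (simp add: minus_scalar_prod_distrib[where n = n])
  moreover have "(gradient n f y - gradient n f x) \<bullet> (y - x) \<le> L * ((y - x) \<bullet> (y - x))"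
  proof -
    have "(gradient n f y - gradient n f x) \<bullet> (y - x)
        \<le> vnorm (gradient n f y - gradient n f x) * vnorm (y - x)"
      using abs_scalar_prod_le_vnorm[of "gradient n f y - gradient n f x" n "y - x"] x y gx gy
      by simp
    also have "\<dots> \<le> (L * vnorm (y - x)) * vnorm (y - x)"
      using smooth x y by (intro mult_right_mono) (auto simp: smooth_fun_def vnorm_nonneg)
    also have "\<dots> = L * ((y - x) \<bullet> (y - x))"
      by (simp add: vnorm_square[symmetric] power2_eq_square)
    finally show ?thesis .
  qed
  ultimately show ?thesis by linarith
qed

text \<open>
  The quadratic gain over plain convexity comes from the point \<open>w = x\<^sub>* + \<nabla>f x / (2 L)\<close>: the tangent
  plane at \<open>x\<close> bounds \<open>f w\<close> from below, the upper bound at the stationary point \<open>x\<^sub>*\<close> bounds it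
  from above, and the step length \<open>1 / (2 L)\<close> maximizes the difference.
\<close>

lemma minimum_value_lower_bound:
  assumes cvx: "convex_fun n f" and smooth: "smooth_fun n L f" and L: "L > 0"
    and xs: "minimizer n f xs" and x: "x \<in> carrier_vec n"
  shows "f xs \<ge> f x + gradient n f x \<bullet> (xs - x) + (gradient n f x \<bullet> gradient n f x) / (4 * L)"
proof -
  have D: "differentiable_fun n f" using cvx by (simp add: convex_fun_def)
  define d where "d = gradient n f x"
  have d: "d \<in> carrier_vec n" using gradient_carrier[OF D x] by (simp add: d_def)
  have xsc: "xs \<in> carrier_vec n" using xs by (simp add: minimizer_def)
  define w where "w = xs + (1 / (2 * L)) \<cdot>\<^sub>v d"
  have w: "w \<in> carrier_vec n" using xsc d by (simp add: w_def)
  have w1: "w - xs = (1 / (2 * L)) \<cdot>\<^sub>v d" and w2: "w - x = (xs - x) + (1 / (2 * L)) \<cdot>\<^sub>v d"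
    using xsc d x by (auto simp: w_def)
  have "f w \<ge> f x + d \<bullet> (w - x)"
    using cvx x w by (simp add: convex_fun_def d_def)
  moreover have "d \<bullet> (w - x) = d \<bullet> (xs - x) + (d \<bullet> d) / (2 * L)"
    unfolding w2 using xsc x d by (simp add: scalar_prod_add_distrib[where n = n])
  moreover have "f w \<le> f xs + L * ((w - xs) \<bullet> (w - xs))"
    using smooth_convex_upper_bound[OF cvx smooth xsc w] gradient_minimizer[OF D xs, of "w - xs"]
      xsc w by simp
  moreover have "L * ((w - xs) \<bullet> (w - xs)) = (d \<bullet> d) / (4 * L)"
    unfolding w1 using L d by (simp add: field_simps)
  moreover have "(d \<bullet> d) / (2 * L) = (d \<bullet> d) / (4 * L) + (d \<bullet> d) / (4 * L)"
    using L by (simp add: field_simps)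
  ultimately show ?thesis unfolding d_def by linarith
qed

section \<open>One step of the method\<close>

text \<open>
  Expanding \<open>\<parallel>z' - x\<^sub>*\<parallel>\<^sup>2\<close> and using that \<open>y' - x'\<close> is a multiple of \<open>- G x'\<close> reduces the claim to
  inner products of \<open>d = \<nabla>f x'\<close>, the error \<open>e = G x' - d\<close> and \<open>r = z - x\<^sub>*\<close>. Convexity towards \<open>y\<close>
  and towards \<open>x\<^sub>*\<close>, weighted with \<open>A\<close> and \<open>\<alpha>\<close>, cancels \<open>\<alpha> \<langle>d, r\<rangle>\<close>. Since
  \<open>\<parallel>d + e\<parallel>\<^sup>2 / 2 - \<langle>d, d + e\<rangle> = (\<parallel>e\<parallel>\<^sup>2 - \<parallel>d\<parallel>\<^sup>2) / 2\<close>, the remaining second order terms amount to at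
  most \<open>\<alpha>\<^sup>2 \<parallel>e\<parallel>\<^sup>2\<close>. The hypothesis \<open>small\<close> keeps the curvature term \<open>L \<parallel>y' - x'\<parallel>\<^sup>2\<close>
  below \<open>\<alpha>\<^sup>2 \<parallel>G x'\<parallel>\<^sup>2 / (4 (A + \<alpha>))\<close>, and \<open>noise\<close> lets half of the gain \<open>\<alpha> \<parallel>d\<parallel>\<^sup>2 / (4 L)\<close> pay for \<open>\<alpha>\<^sup>2 \<parallel>e\<parallel>\<^sup>2\<close>.
\<close>

lemma similar_triangles_step:
  fixes A \<alpha> L eps :: real
  assumes cvx: "convex_fun n f" and smooth: "smooth_fun n L f" and L: "L > 0"
    and xs: "minimizer n f xs" and orc: "gradient_oracle n f eps G"
    and A: "A \<ge> 0" and \<alpha>: "\<alpha> > 0"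
    and small: "4 * L * \<alpha>\<^sup>2 \<le> A + \<alpha>" and noise: "8 * L * \<alpha> * eps\<^sup>2 \<le> 1"
    and y: "y \<in> carrier_vec n" and z: "z \<in> carrier_vec n"
  defines "x' \<equiv> (1 / (A + \<alpha>)) \<cdot>\<^sub>v (A \<cdot>\<^sub>v y + \<alpha> \<cdot>\<^sub>v z)"
  defines "z' \<equiv> z - \<alpha> \<cdot>\<^sub>v G x'"
  defines "y' \<equiv> (1 / (A + \<alpha>)) \<cdot>\<^sub>v (A \<cdot>\<^sub>v y + \<alpha> \<cdot>\<^sub>v z')"
  shows "(A + \<alpha>) * (f y' - f xs) + (vnorm (z' - xs))\<^sup>2 / 2
    \<le> A * (f y - f xs) + (vnorm (z - xs))\<^sup>2 / 2 + 2 * \<alpha> * L * eps\<^sup>2 * (vnorm (z - xs))\<^sup>2"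
proof -
  have D: "differentiable_fun n f" using cvx by (simp add: convex_fun_def)
  have xsc: "xs \<in> carrier_vec n" using xs by (simp add: minimizer_def)
  have x': "x' \<in> carrier_vec n" using y z by (simp add: x'_def)
  have A\<alpha>: "A + \<alpha> > 0" using A \<alpha> by simp
  define g where "g = G x'"
  define d where "d = gradient n f x'"
  define e where "e = g - d"
  define r where "r = z - xs"
  define h where "h = \<alpha>\<^sup>2 / (A + \<alpha>)"
  have g: "g \<in> carrier_vec n" using orc x' by (simp add: g_def gradient_oracle_def)
  have d: "d \<in> carrier_vec n" using gradient_carrier[OF D x'] by (simp add: d_def)
  have e: "e \<in> carrier_vec n" using g d by (simp add: e_def)
  have r: "r \<in> carrier_vec n" using z xsc by (simp add: r_def)
  have z'_eq: "z' = z - \<alpha> \<cdot>\<^sub>v g" by (simp add: z'_def g_def)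
  have z': "z' \<in> carrier_vec n" using z g by (simp add: z'_eq)
  have y': "y' \<in> carrier_vec n" using y z' by (simp add: y'_def)
  have g_eq: "g = d + e" using g d by (intro eq_vecI) (auto simp: e_def)
  have z'_diff: "z' - xs = r + (- \<alpha>) \<cdot>\<^sub>v g"
    using z xsc g by (intro eq_vecI) (auto simp: z'_eq r_def)
  \<comment> \<open>The sum \<open>A + \<alpha>\<close> has to be atomic here, or \<open>field_simps\<close> multiplies the denominators out.\<close>
  have y'_diff: "y' - x' = (- h) \<cdot>\<^sub>v g"
  proof -
    obtain s where s: "s = A + \<alpha>" by simp
    show ?thesis
      unfolding y'_def x'_def z'_eq h_def s[symmetric] using y z g A\<alpha>[folded s]
      by (intro eq_vecI) (auto simp: field_simps power2_eq_square)
  qed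
  \<comment> \<open>This rearranges \<open>A (y - x') + \<alpha> (z - x') = 0\<close>, the defining property of \<open>x'\<close>.\<close>
  have coupling: "A \<cdot>\<^sub>v (y - x') + \<alpha> \<cdot>\<^sub>v (xs - x') = (- \<alpha>) \<cdot>\<^sub>v r"
  proof -
    obtain s where s: "s = A + \<alpha>" by simp
    have A: "A = s - \<alpha>" using s by simp
    show ?thesis
      unfolding x'_def r_def s[symmetric] unfolding A using y z xsc A\<alpha>[folded s]
      by (intro eq_vecI) (auto simp: field_simps)
  qed
  have c_eq: "A * (d \<bullet> (y - x')) + \<alpha> * (d \<bullet> (xs - x')) = - \<alpha> * (d \<bullet> r)"
  proof -
    have "d \<bullet> (A \<cdot>\<^sub>v (y - x') + \<alpha> \<cdot>\<^sub>v (xs - x')) = A * (d \<bullet> (y - x')) + \<alpha> * (d \<bullet> (xs - x'))"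
      using d y x' xsc by (simp add: scalar_prod_add_distrib[where n = n])
    then show ?thesis using d r by (simp add: coupling)
  qed
  have gg: "g \<bullet> g = d \<bullet> d + 2 * (d \<bullet> e) + e \<bullet> e"
    using scalar_prod_add_self[OF d e] by (simp add: g_eq)
  have dg: "d \<bullet> g = d \<bullet> d + d \<bullet> e"
    using d e by (simp add: g_eq scalar_prod_add_distrib[where n = n])
  have rg: "r \<bullet> g = d \<bullet> r + e \<bullet> r"
    using d e r by (simp add: g_eq scalar_prod_add_distrib[where n = n]
        comm_scalar_prod[of r n])
  have e_norm: "vnorm e \<le> eps * vnorm d"
    using orc x' by (simp add: gradient_oracle_def e_def g_def d_def)
  have ee: "e \<bullet> e \<le> eps\<^sup>2 * (d \<bullet> d)"
    using power_mono[OF e_norm vnorm_nonneg, of 2] by (simp add: power_mult_distrib vnorm_square)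
  have young: "2 * (d \<bullet> e) \<le> d \<bullet> d + e \<bullet> e"
  proof -
    have "0 \<le> (d - e) \<bullet> (d - e)" by (simp flip: vnorm_square)
    also have "\<dots> = d \<bullet> d - 2 * (d \<bullet> e) + e \<bullet> e"
      using d e by (simp add: minus_scalar_prod_distrib[where n = n]
          scalar_prod_minus_distrib[where n = n] comm_scalar_prod[of e n d])
    finally show ?thesis by simp
  qed
  have er: "- (e \<bullet> r) \<le> (d \<bullet> d) / (8 * L) + 2 * L * eps\<^sup>2 * (r \<bullet> r)"
  proof -
    have "- (e \<bullet> r) \<le> vnorm e * vnorm r"
      using abs_scalar_prod_le_vnorm[OF e r] by simp
    also have "\<dots> \<le> eps * vnorm d * vnorm r"
      using e_norm by (intro mult_right_mono vnorm_nonneg)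
    also have "\<dots> \<le> (vnorm d)\<^sup>2 / (8 * L) + 2 * L * eps\<^sup>2 * (vnorm r)\<^sup>2"
    proof -
      \<comment> \<open>The weight \<open>4 L\<close> makes the term in \<open>d\<close> exactly the unspent half of the gain.\<close>
      have "0 \<le> (vnorm d - 4 * L * eps * vnorm r)\<^sup>2 / (8 * L)" using L by simp
      also have "\<dots> = (vnorm d)\<^sup>2 / (8 * L) + 2 * L * eps\<^sup>2 * (vnorm r)\<^sup>2
          - eps * vnorm d * vnorm r"
        using L by (simp add: field_simps power2_eq_square)
      finally show ?thesis by simp
    qed
    finally show ?thesis by (simp add: vnorm_square)
  qed
  have f_y: "A * f x' + A * (d \<bullet> (y - x')) \<le> A * f y"
  proof -
    have "f x' + d \<bullet> (y - x') \<le> f y"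
      using cvx x' y by (simp add: convex_fun_def d_def)
    from mult_left_mono[OF this A] show ?thesis by (simp add: distrib_left)
  qed
  have f_xs: "\<alpha> * f x' + \<alpha> * (d \<bullet> (xs - x')) + \<alpha> * ((d \<bullet> d) / (4 * L)) \<le> \<alpha> * f xs"
    using mult_left_mono[OF minimum_value_lower_bound[OF cvx smooth L xs x'], of \<alpha>] \<alpha>
    by (simp add: d_def distrib_left)
  have f_y': "(A + \<alpha>) * f y' \<le> (A + \<alpha>) * f x' - \<alpha>\<^sup>2 * (d \<bullet> g) + \<alpha>\<^sup>2 / 4 * (g \<bullet> g)"
  proof -
    have "f y' \<le> f x' - h * (d \<bullet> g) + L * h\<^sup>2 * (g \<bullet> g)"
      using smooth_convex_upper_bound[OF cvx smooth x' y'] d g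
      by (simp add: y'_diff d_def[symmetric] power2_eq_square algebra_simps)
    then have "(A + \<alpha>) * f y' \<le> (A + \<alpha>) * (f x' - h * (d \<bullet> g) + L * h\<^sup>2 * (g \<bullet> g))"
      using A\<alpha> by simp
    also have "\<dots> = (A + \<alpha>) * f x' - \<alpha>\<^sup>2 * (d \<bullet> g) + (L * \<alpha>\<^sup>2 / (A + \<alpha>)) * \<alpha>\<^sup>2 * (g \<bullet> g)"
    proof -
      have h1: "(A + \<alpha>) * h = \<alpha>\<^sup>2" using A\<alpha> by (simp add: h_def)
      have "(A + \<alpha>) * (L * h\<^sup>2 * (g \<bullet> g)) = L * h * ((A + \<alpha>) * h) * (g \<bullet> g)"
        by (simp add: power2_eq_square)
      also have "\<dots> = (L * \<alpha>\<^sup>2 / (A + \<alpha>)) * \<alpha>\<^sup>2 * (g \<bullet> g)"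
        unfolding h1 by (simp add: h_def)
      finally show ?thesis using h1
        by (simp add: distrib_left right_diff_distrib mult.assoc[symmetric])
    qed
    also have "(L * \<alpha>\<^sup>2 / (A + \<alpha>)) * \<alpha>\<^sup>2 * (g \<bullet> g) \<le> (1 / 4) * \<alpha>\<^sup>2 * (g \<bullet> g)"
      using small A\<alpha>
      by (intro mult_right_mono) (auto simp: field_simps simp flip: vnorm_square)
    finally show ?thesis by simp
  qed
  have dist: "(z' - xs) \<bullet> (z' - xs) = r \<bullet> r - 2 * \<alpha> * (r \<bullet> g) + \<alpha>\<^sup>2 * (g \<bullet> g)"
    unfolding z'_diff using scalar_prod_add_self[of r n "(- \<alpha>) \<cdot>\<^sub>v g"] r g
    by (simp add: power2_eq_square)
  have er': "- \<alpha> * (e \<bullet> r) \<le> \<alpha> * ((d \<bullet> d) / (8 * L)) + 2 * \<alpha> * L * eps\<^sup>2 * (r \<bullet> r)"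
    using mult_left_mono[OF er, of \<alpha>] \<alpha> by (simp add: algebra_simps)
  have ee': "\<alpha>\<^sup>2 * (e \<bullet> e) \<le> \<alpha> * ((d \<bullet> d) / (8 * L))"
  proof -
    have "\<alpha>\<^sup>2 * (e \<bullet> e) \<le> \<alpha>\<^sup>2 * (eps\<^sup>2 * (d \<bullet> d))"
      using ee by (simp add: mult_left_mono)
    also have "\<dots> = (8 * L * \<alpha> * eps\<^sup>2) * (\<alpha> * ((d \<bullet> d) / (8 * L)))"
      using L by (simp add: field_simps power2_eq_square)
    also have "\<dots> \<le> 1 * (\<alpha> * ((d \<bullet> d) / (8 * L)))"
      using noise \<alpha> L by (intro mult_right_mono) (auto simp flip: vnorm_square)
    finally show ?thesis by simp
  qed
  have young': "\<alpha>\<^sup>2 * (2 * (d \<bullet> e)) \<le> \<alpha>\<^sup>2 * (d \<bullet> d) + \<alpha>\<^sup>2 * (e \<bullet> e)"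
    using young by (simp add: mult_left_mono flip: distrib_left)
  have quarter: "\<alpha> * ((d \<bullet> d) / (4 * L)) = \<alpha> * ((d \<bullet> d) / (8 * L)) + \<alpha> * ((d \<bullet> d) / (8 * L))"
    using L by (simp add: field_simps)
  define b where "b = \<alpha> * ((d \<bullet> d) / (8 * L))"
  have second_order: "\<alpha>\<^sup>2 / 2 * (g \<bullet> g) - \<alpha>\<^sup>2 * (d \<bullet> g) + \<alpha>\<^sup>2 / 4 * (g \<bullet> g) \<le> b"
    using ee'[folded b_def] young' unfolding gg dg by (simp add: algebra_simps)
  have first_order: "- \<alpha> * (r \<bullet> g) \<le> b + 2 * \<alpha> * L * eps\<^sup>2 * (r \<bullet> r) - \<alpha> * (d \<bullet> r)"
    using er'[folded b_def] unfolding rg by (simp add: algebra_simps)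
  have combined: "(A + \<alpha>) * f x' - \<alpha> * (d \<bullet> r) + 2 * b \<le> A * f y + \<alpha> * f xs"
    using f_y f_xs[unfolded quarter, folded b_def] c_eq by (simp add: distrib_right)
  have "(A + \<alpha>) * (f y' - f xs) + (r \<bullet> r - 2 * \<alpha> * (r \<bullet> g) + \<alpha>\<^sup>2 * (g \<bullet> g)) / 2
      = (A + \<alpha>) * f y' - A * f xs - \<alpha> * f xs + r \<bullet> r / 2 - \<alpha> * (r \<bullet> g) + \<alpha>\<^sup>2 / 2 * (g \<bullet> g)"
    by (simp add: field_simps)
  also have "\<dots> \<le> A * f y - A * f xs + r \<bullet> r / 2 + 2 * \<alpha> * L * eps\<^sup>2 * (r \<bullet> r)"
    using f_y' second_order first_order combined by linarith
  finally show ?thesis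
    unfolding vnorm_square dist r_def[symmetric] by (simp add: right_diff_distrib)
qed

section \<open>Growth of the weights\<close>

text \<open>
  The function \<open>m\<^sup>q / m\<close> is nonincreasing for \<open>q \<le> 1\<close>. With \<open>p = 1 + q\<close> this bounds the increment
  of \<open>m\<^sup>p\<close> by \<open>2 (m + 1)\<^sup>q\<close>, which is the induction step for the lower bound on the weights.
\<close>

lemma succ_powr_le:
  assumes "q \<le> 1"
  shows "real m * (real m + 1) powr q \<le> (real m + 1) * real m powr q"
proof (cases "m = 0")
  case False
  then have m: "real m > 0" by simp
  have "((real m + 1) / real m) powr q \<le> ((real m + 1) / real m) powr 1"
    using m assms by (intro powr_mono) (auto simp: field_simps)
  then have "(real m + 1) powr q / real m powr q \<le> (real m + 1) / real m"
    using m by (simp add: powr_divide)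
  then show ?thesis using m by (simp add: field_simps)
qed simp

lemma istm_A_lower:
  assumes "a > 0" "L > 0" "1 \<le> p" "p \<le> 2" "k \<ge> 1"
  shows "(real k + 1) powr p \<le> 4 * a * L * istm_A L a p k"
  using assms(5)
proof (induction k rule: dec_induct)
  case base
  have "2 * (2 :: real) powr (p - 1) = 2 powr p"
    by (simp add: powr_diff)
  then show ?case using assms by (simp add: field_simps)
next
  case (step k)
  define m where "m = Suc k"
  define q where "q = p - 1"
  have q: "0 \<le> q" "q \<le> 1" "p = 1 + q" using assms by (auto simp: q_def)
  have A: "4 * a * L * istm_A L a p (Suc k) = 4 * a * L * istm_A L a p k + 2 * (real m + 1) powr q"
    using assms by (simp add: m_def q_def field_simps)
  have "real m powr q \<le> (real m + 1) powr q"
    using q by (intro powr_mono2) auto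
  then have "(real m + 1) powr p \<le> real m powr p + 2 * (real m + 1) powr q"
    using succ_powr_le[OF q(2), of m] by (simp add: q(3) powr_add algebra_simps)
  then show ?case using A step.IH by (simp add: m_def add.commute)
qed

lemma istm_A_upper:
  assumes "a > 0" "L > 0" "1 \<le> p"
  shows "2 * a * L * istm_A L a p k \<le> real k * (real k + 1) powr (p - 1)"
proof (induction k)
  case (Suc k)
  have "real k * (real k + 1) powr (p - 1) \<le> real k * (real k + 2) powr (p - 1)"
    using assms by (intro mult_left_mono powr_mono2) auto
  then show ?case using Suc assms by (simp add: field_simps)
qed simp

lemma istm_alpha_pos: "a > 0 \<Longrightarrow> L > 0 \<Longrightarrow> istm_alpha L a p (Suc k) > 0"
  by simp

lemma istm_A_nonneg: "a > 0 \<Longrightarrow> L > 0 \<Longrightarrow> istm_A L a p k \<ge> 0"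
  by (induction k) auto

lemma istm_A_mono:
  assumes "a > 0" "L > 0" "j \<le> k"
  shows "istm_A L a p j \<le> istm_A L a p k"
  using assms(3) by (rule lift_Suc_mono_le[rotated]) (use assms in simp)

text \<open>
  \<open>\<alpha>\<close> grows like \<open>k\<^sup>p\<^sup>-\<^sup>1\<close> and \<open>A\<close> like \<open>k\<^sup>p\<close>, so a bound of \<open>\<alpha>\<^sup>2\<close> by a multiple of \<open>A\<close>
  forces \<open>2 (p - 1) \<le> p\<close>, that is, \<open>p \<le> 2\<close>.
\<close>

lemma istm_alpha_small:
  assumes "a \<ge> 8" "L > 0" "1 \<le> p" "p \<le> 2"
  shows "4 * L * (istm_alpha L a p (Suc k))\<^sup>2 \<le> istm_A L a p (Suc k)"
proof -
  define m where "m = real k + 2"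
  have m: "m \<ge> 2" by (simp add: m_def)
  have "4 * L * (istm_alpha L a p (Suc k))\<^sup>2 = (m powr (p - 1))\<^sup>2 / (a\<^sup>2 * L)"
    using assms by (simp add: m_def field_simps power2_eq_square)
  also have "(m powr (p - 1))\<^sup>2 = m powr (2 * (p - 1))"
    using m by (simp add: powr_powr powr_power)
  also have "\<dots> \<le> m powr p"
    using m assms by (intro powr_mono) auto
  also have "m powr p / (a\<^sup>2 * L) \<le> (4 * a * L * istm_A L a p (Suc k)) / (a\<^sup>2 * L)"
    using istm_A_lower[of a L p "Suc k"] assms
    by (intro divide_right_mono) (auto simp: m_def add.commute)
  also have "\<dots> = (4 / a) * istm_A L a p (Suc k)"
    using assms by (simp add: field_simps power2_eq_square)
  also have "\<dots> \<le> 1 * istm_A L a p (Suc k)"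
    using assms istm_A_nonneg[of a L p "Suc k"] by (intro mult_right_mono) auto
  finally show ?thesis using assms by (simp add: divide_right_mono)
qed

lemma istm_A_le:
  assumes "a > 0" "L > 0" "1 \<le> p" "p \<le> 2" "N \<ge> 1"
  shows "a * L * istm_A L a p N \<le> real N powr p"
proof -
  have "(real N + 1) powr (p - 1) \<le> (2 * real N) powr (p - 1)"
    using assms by (intro powr_mono2) auto
  also have "\<dots> = 2 powr (p - 1) * real N powr (p - 1)"
    by (simp add: powr_mult)
  also have "\<dots> \<le> 2 powr 1 * real N powr (p - 1)"
    using assms by (intro mult_right_mono powr_mono) auto
  finally have "real N * (real N + 1) powr (p - 1) \<le> real N * (2 * real N powr (p - 1))"
    by (intro mult_left_mono) auto
  also have "\<dots> = 2 * real N powr p"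
    using assms by (simp add: powr_diff)
  finally show ?thesis using istm_A_upper[of a L p N] assms by simp
qed

section \<open>Convergence\<close>

text \<open>
  The bound on the potential and the bound \<open>\<parallel>z\<^sub>k - x\<^sub>*\<parallel>\<^sup>2 \<le> 2 R\<^sub>0\<^sup>2\<close> need each other: the potential
  controls the distance, and the distance controls how much noise the next step adds. The hypothesis
  \<open>noise\<close> says that the noise accumulated up to time \<open>N\<close> does not break this loop.
\<close>

lemma istm_potential:
  assumes cvx: "convex_fun n f" and smooth: "smooth_fun n L f" and L: "L > 0"
    and xs: "minimizer n f xs" and orc: "gradient_oracle n f eps G"
    and p: "1 \<le> p" "p \<le> 2" and a: "a \<ge> 8" and x0: "x0 \<in> carrier_vec n"
    and noise: "8 * L * eps\<^sup>2 * istm_A L a p N \<le> 1"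
  shows "k \<le> N \<Longrightarrow> istm G L a p x0 k = (x, y, z) \<Longrightarrow>
    y \<in> carrier_vec n \<and> z \<in> carrier_vec n \<and>
    istm_A L a p k * (f y - f xs) + (vnorm (z - xs))\<^sup>2 / 2
      \<le> (1 / 2 + 4 * L * eps\<^sup>2 * istm_A L a p k) * (vnorm (x0 - xs))\<^sup>2"
proof (induction k arbitrary: x y z)
  case 0
  then show ?case using x0 by auto
next
  case (Suc k)
  obtain u v w where st: "istm G L a p x0 k = (u, v, w)"
    using prod_cases3 by blast
  define A where "A = istm_A L a p k"
  define \<alpha> where "\<alpha> = istm_alpha L a p (Suc k)"
  have a0: "a > 0" using a by simp
  have A: "A \<ge> 0" and \<alpha>: "\<alpha> > 0" and A': "istm_A L a p (Suc k) = A + \<alpha>"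
    using istm_A_nonneg[OF a0 L] istm_alpha_pos[OF a0 L] by (simp_all add: A_def \<alpha>_def)
  define R where "R = (vnorm (x0 - xs))\<^sup>2"
  have v: "v \<in> carrier_vec n" and w: "w \<in> carrier_vec n"
    and IH: "A * (f v - f xs) + (vnorm (w - xs))\<^sup>2 / 2 \<le> (1 / 2 + 4 * L * eps\<^sup>2 * A) * R"
    using Suc.IH[OF _ st] Suc.prems(1) by (auto simp: A_def R_def)
  have noise': "8 * L * eps\<^sup>2 * (A + \<alpha>) \<le> 1"
  proof -
    have "8 * L * eps\<^sup>2 * (A + \<alpha>) \<le> 8 * L * eps\<^sup>2 * istm_A L a p N"
      using istm_A_mono[OF a0 L Suc.prems(1), of p] L unfolding A' by (intro mult_left_mono) auto
    then show ?thesis using noise by simp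
  qed
  have split: "8 * L * eps\<^sup>2 * (A + \<alpha>) = 8 * L * eps\<^sup>2 * A + 8 * L * \<alpha> * eps\<^sup>2"
    by (simp add: algebra_simps)
  have pos: "0 \<le> 8 * L * eps\<^sup>2 * A" "0 \<le> 8 * L * \<alpha> * eps\<^sup>2"
    using L A \<alpha> by auto
  have gap: "0 \<le> A * (f v - f xs)"
    using xs v A by (simp add: minimizer_def)
  have dist: "(vnorm (w - xs))\<^sup>2 \<le> 2 * R"
  proof -
    have "(1 / 2 + 4 * L * eps\<^sup>2 * A) * R \<le> 1 * R"
      using noise' split pos by (intro mult_right_mono) (auto simp: R_def)
    then show ?thesis using IH gap by simp
  qed
  define x' where "x' = (1 / (A + \<alpha>)) \<cdot>\<^sub>v (A \<cdot>\<^sub>v v + \<alpha> \<cdot>\<^sub>v w)"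
  define z' where "z' = w - \<alpha> \<cdot>\<^sub>v G x'"
  define y' where "y' = (1 / (A + \<alpha>)) \<cdot>\<^sub>v (A \<cdot>\<^sub>v v + \<alpha> \<cdot>\<^sub>v z')"
  have eqs: "y = y'" "z = z'"
    using Suc.prems(2) st A' by (auto simp: Let_def A_def \<alpha>_def x'_def y'_def z'_def)
  have x': "x' \<in> carrier_vec n" using v w by (simp add: x'_def)
  have z': "z' \<in> carrier_vec n" using w x' orc by (simp add: z'_def gradient_oracle_def)
  have y': "y' \<in> carrier_vec n" using v z' by (simp add: y'_def)
  have "(A + \<alpha>) * (f y' - f xs) + (vnorm (z' - xs))\<^sup>2 / 2
    \<le> A * (f v - f xs) + (vnorm (w - xs))\<^sup>2 / 2 + 2 * \<alpha> * L * eps\<^sup>2 * (vnorm (w - xs))\<^sup>2"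
    unfolding y'_def z'_def x'_def
    by (rule similar_triangles_step[OF cvx smooth L xs orc A \<alpha> _ _ v w])
      (use istm_alpha_small[OF a L p, of k, folded \<alpha>_def] A' noise' split pos in linarith)+
  also have "\<dots> \<le> (1 / 2 + 4 * L * eps\<^sup>2 * A) * R + 2 * \<alpha> * L * eps\<^sup>2 * (2 * R)"
    using IH dist \<alpha> L by (intro add_mono mult_left_mono) auto
  also have "\<dots> = (1 / 2 + 4 * L * eps\<^sup>2 * (A + \<alpha>)) * R"
    by (simp add: algebra_simps)
  finally show ?case using y' z' eqs A' by (simp add: R_def)
qed

lemma istm_convergence:
  assumes cvx: "convex_fun n f" and smooth: "smooth_fun n L f" and L: "L > 0"
    and xs: "minimizer n f xs" and orc: "gradient_oracle n f eps G"
    and p: "1 \<le> p" "p \<le> 2" and a: "a \<ge> 8" "a \<ge> 8 * (real N powr p * eps\<^sup>2)"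
    and N: "N \<ge> 1" and x0: "x0 \<in> carrier_vec n"
  shows "f (istm_output G L a p x0 N) - f xs
    \<le> 4 * a * L * (vnorm (x0 - xs))\<^sup>2 / (real N + 1) powr p"
proof -
  define AN where "AN = istm_A L a p N"
  define R where "R = (vnorm (x0 - xs))\<^sup>2"
  have a0: "a > 0" using a by simp
  have "a * (8 * L * eps\<^sup>2 * AN) = 8 * eps\<^sup>2 * (a * L * AN)"
    by simp
  also have "\<dots> \<le> 8 * eps\<^sup>2 * real N powr p"
    unfolding AN_def by (intro mult_left_mono istm_A_le a0 L p N) auto
  also have "\<dots> \<le> a * 1" using a by (simp add: mult_ac)
  finally have noise: "8 * L * eps\<^sup>2 * AN \<le> 1" using a0 by simp
  obtain x y z where st: "istm G L a p x0 N = (x, y, z)"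
    using prod_cases3 by blast
  have "y \<in> carrier_vec n \<and> z \<in> carrier_vec n \<and>
    AN * (f y - f xs) + (vnorm (z - xs))\<^sup>2 / 2 \<le> (1 / 2 + 4 * L * eps\<^sup>2 * AN) * R"
    using istm_potential[OF cvx smooth L xs orc p a(1) x0 _ order_refl st] noise
    by (simp add: AN_def R_def)
  moreover have "(1 / 2 + 4 * L * eps\<^sup>2 * AN) * R \<le> 1 * R"
    using noise by (intro mult_right_mono) (auto simp: R_def)
  moreover have "0 \<le> (vnorm (z - xs))\<^sup>2" by simp
  ultimately have pot: "AN * (f y - f xs) \<le> R" and y: "y \<in> carrier_vec n"
    by linarith+
  have gap: "0 \<le> f y - f xs" using xs y by (simp add: minimizer_def)
  have "(real N + 1) powr p * (f y - f xs) \<le> 4 * a * L * AN * (f y - f xs)"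
    using istm_A_lower[OF a0 L p N] gap unfolding AN_def by (intro mult_right_mono)
  also have "\<dots> \<le> 4 * a * L * R"
    using mult_left_mono[OF pot, of "4 * a * L"] a0 L by (simp add: mult_ac)
  finally show ?thesis
    by (simp add: istm_output_def st R_def field_simps)
qed

theorem theorem3p1:
  shows "\<exists>c c' :: real. c \<ge> 1 \<and> c' > 0 \<and>
    (\<forall>(n :: nat) (f :: real vec \<Rightarrow> real) (L :: real) (xs :: real vec) (eps :: real)
       (G :: real vec \<Rightarrow> real vec) (p :: real) (N :: nat) (x0 :: real vec).
       L > 0 \<longrightarrow> convex_fun n f \<longrightarrow> smooth_fun n L f \<longrightarrow> minimizer n f xs \<longrightarrow>
       0 \<le> eps \<longrightarrow> eps \<le> 1 \<longrightarrow> gradient_oracle n f eps G \<longrightarrow>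
       1 \<le> p \<longrightarrow> p \<le> 2 \<longrightarrow> 1 \<le> N \<longrightarrow> x0 \<in> carrier_vec n \<longrightarrow>
       (let a = c * Max {1, real N powr (p / 4) * sqrt eps, real N powr (p / 2) * eps,
                         real N powr p * eps\<^sup>2};
            R0 = vnorm (x0 - xs);
            C1 = sqrt 2;
            yN = istm_output G L a p x0 N
        in f yN - f xs \<le> 8 * a * L * C1\<^sup>2 * R0\<^sup>2 / (real N + 1) powr p \<and>
           f yN - f xs \<le> c' * Max {L * R0\<^sup>2 / real N powr p,
                                   sqrt eps * L * R0\<^sup>2 / real N powr (3 * p / 4),
                                   eps * L * R0\<^sup>2 / real N powr (p / 2),
                                   eps\<^sup>2 * L * R0\<^sup>2}))"
proof (rule exI[of _ 8], rule exI[of _ 32], intro conjI allI impI)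
  fix n :: nat and f :: "real vec \<Rightarrow> real" and L :: real and xs :: "real vec" and eps :: real
    and G :: "real vec \<Rightarrow> real vec" and p :: real and N :: nat and x0 :: "real vec"
  assume L: "L > 0" and cvx: "convex_fun n f" and smooth: "smooth_fun n L f"
    and xs: "minimizer n f xs" and eps: "0 \<le> eps" "eps \<le> 1" and orc: "gradient_oracle n f eps G"
    and p: "1 \<le> p" "p \<le> 2" and N: "1 \<le> N" and x0: "x0 \<in> carrier_vec n"
  define M where "M = Max {1, real N powr (p / 4) * sqrt eps, real N powr (p / 2) * eps,
                         real N powr p * eps\<^sup>2}"
  define R where "R = (vnorm (x0 - xs))\<^sup>2"
  define M' where "M' = Max {L * R / real N powr p, sqrt eps * L * R / real N powr (3 * p / 4),
                             eps * L * R / real N powr (p / 2), eps\<^sup>2 * L * R}"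
  define gap where "gap = f (istm_output G L (8 * M) p x0 N) - f xs"
  have R: "R \<ge> 0" by (simp add: R_def)
  have M: "M \<ge> 1" "M \<ge> real N powr p * eps\<^sup>2"
    unfolding M_def by (intro Max_ge; simp)+
  have bound: "gap \<le> 4 * (8 * M) * L * R / (real N + 1) powr p"
    unfolding gap_def R_def
    by (rule istm_convergence[OF cvx smooth L xs orc p _ _ N x0]) (use M in auto)
  have first: "gap \<le> 8 * (8 * M) * L * (sqrt 2)\<^sup>2 * R / (real N + 1) powr p"
  proof -
    have "4 * (8 * M) * L * R \<le> 8 * (8 * M) * L * (sqrt 2)\<^sup>2 * R"
      using M L R by simp
    then show ?thesis using bound by (meson divide_right_mono order_trans powr_ge_zero)
  qed
  \<comment> \<open>Division by \<open>N\<^sup>p\<close> maps the entries of the maximum \<open>M\<close> to those of \<open>M'\<close>, one by one.\<close>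
  have scale: "M * (L * R / real N powr p) \<le> M'"
  proof -
    define T where "T = real N powr p"
    have T: "T > 0" using N by (simp add: T_def)
    have quot: "real N powr q / T = 1 / real N powr (p - q)" for q
      using N by (simp add: T_def powr_diff)
    have terms: "M = 1 \<or> M = real N powr (p / 4) * sqrt eps \<or> M = real N powr (p / 2) * eps
        \<or> M = T * eps\<^sup>2"
      using Max_in[of "{1, real N powr (p / 4) * sqrt eps, real N powr (p / 2) * eps,
                         real N powr p * eps\<^sup>2}"] by (simp add: M_def T_def)
    have le: "L * R / T \<le> M'" "sqrt eps * L * R / real N powr (3 * p / 4) \<le> M'"
      "eps * L * R / real N powr (p / 2) \<le> M'" "eps\<^sup>2 * L * R \<le> M'"
      unfolding M'_def T_def by (intro Max_ge; simp)+
    have "real N powr (p / 4) * sqrt eps * (L * R / T) = sqrt eps * L * R / real N powr (3 * p / 4)"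
    proof -
      have "real N powr (p / 4) * sqrt eps * (L * R / T)
          = sqrt eps * L * R * (real N powr (p / 4) / T)" by simp
      also have "p - p / 4 = 3 * p / 4" by simp
      then have "real N powr (p / 4) / T = 1 / real N powr (3 * p / 4)"
        using quot[of "p / 4"] by simp
      finally show ?thesis by simp
    qed
    moreover have "real N powr (p / 2) * eps * (L * R / T) = eps * L * R / real N powr (p / 2)"
    proof -
      have "real N powr (p / 2) * eps * (L * R / T)
          = eps * L * R * (real N powr (p / 2) / T)" by simp
      also have "real N powr (p / 2) / T = 1 / real N powr (p / 2)"
        using quot[of "p / 2"] by simp
      finally show ?thesis by simp
    qed
    moreover have "T * eps\<^sup>2 * (L * R / T) = eps\<^sup>2 * L * R"
      using T by simp
    ultimately show ?thesis using terms le unfolding T_def[symmetric] by (metis mult_1)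
  qed
  have second: "gap \<le> 32 * M'"
  proof -
    have "4 * (8 * M) * L * R / (real N + 1) powr p \<le> 4 * (8 * M) * L * R / real N powr p"
      using M L R N p by (intro divide_left_mono powr_mono2 mult_pos_pos) auto
    also have "\<dots> = 32 * (M * (L * R / real N powr p))" by simp
    finally show ?thesis using bound scale by linarith
  qed
  show "let a = 8 * Max {1, real N powr (p / 4) * sqrt eps, real N powr (p / 2) * eps,
                         real N powr p * eps\<^sup>2};
            R0 = vnorm (x0 - xs);
            C1 = sqrt 2;
            yN = istm_output G L a p x0 N
        in f yN - f xs \<le> 8 * a * L * C1\<^sup>2 * R0\<^sup>2 / (real N + 1) powr p \<and>
           f yN - f xs \<le> 32 * Max {L * R0\<^sup>2 / real N powr p,
                                   sqrt eps * L * R0\<^sup>2 / real N powr (3 * p / 4),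
                                   eps * L * R0\<^sup>2 / real N powr (p / 2),
                                   eps\<^sup>2 * L * R0\<^sup>2}"
    using first second
    unfolding Let_def M_def[symmetric] R_def[symmetric] M'_def[symmetric] gap_def by simp
qed simp_all

end
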